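(* Let $\mathbb A$ and $\mathbb B$ be relational structures over the same domain. Then $\mathbb A$ q-defines $\mathbb B$ if, and only if, $\mathrm{qPol}(\mathbb A)\subseteq\mathrm{qPol}(\mathbb B)$.
   Context: Structures: a signature $\sigma$ is a finite set of relation symbols $R$ with arities $\mathrm{ar}(R)\ge 1$; a $\sigma$-structure $\mathbb A$ consists of a finite domain $A$ and relations $R^{\mathbb A}\subseteq A^{\mathrm{ar}(R)}$ for $R\in\sigma$. All structures are finite; $\mathbb A$ and $\mathbb B$ may have different signatures. $\mathrm{Gaif}(\mathbb A)$ is the loopless undirected graph on $A$ in which distinct $x,y$ are adjacent iff they occur together in some tuple of some relation of $\mathbb A$. For $n\ge 1$, the power $\mathbb A^n$ has domain $A^n$, and $(\mathbf b_1,\dots,\mathbf b_r)\in R^{\mathbb A^n}$ iff for every $i\in[n]$ the tuple of $i$-th coordinates lies in $R^{\mathbb A}$. For $S\subseteq A^r$, $(A;S)$ is the structure with domain $A$ and the single relation $S$. Quantum homomorphisms: a projector on a finite-dimensional Hilbert space $H$ is an operator $p$ with $p=p^*=p^2$. A PVM on $H$ with outcome set $B$ is a family $(Q_b)_{b\in B}$ of projectors with $\sum_b Q_b=\mathrm{id}$. A quantum function $Q$ from $A$ to $B$ is a family of PVMs $(Q_{a,b})_{b\in B}$, one for each $a\in A$, all over the same non-trivial finite-dimensional Hilbert space. A quantum homomorphism $Q:\mathbb A\to_q\mathbb B$ between $\sigma$-structures is a quantum function from $A$ to $B$ such that (QH1) $\prod_{i=1}^{\mathrm{ar}(R)}Q_{a_i,b_i}=0$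 for all $R\in\sigma$, $\mathbf a\in R^{\mathbb A}$, $\mathbf b\in B^{\mathrm{ar}(R)}\setminus R^{\mathbb B}$; (QH2) $Q_{a,b}Q_{a',b'}=Q_{a',b'}Q_{a,b}$ for all $\{a,a'\}\in E(\mathrm{Gaif}(\mathbb A))$ and $b,b'\in B$. $\mathrm{qPol}(\mathbb A)$ is the set of all quantum polymorphisms of $\mathbb A$, i.e., quantum homomorphisms $\mathbb A^n\to_q\mathbb A$ for $n\ge1$ (each regarded as a quantum function from $A^n$ to $A$). q-definitions: let $\mathbb A$ be a $\sigma$-structure and $S\subseteq A^r$. Let $\mathbb R$ be the structure with domain $[r]$ and a single $r$-ary relation $\{(1,\dots,r)\}$ (in the signature of $(A;S)$). A q-definition of $S$ in $\mathbb A$ is a $\sigma$-structure $\mathbb G$ with distinguished vertices $g_1,\dots,g_r$ (not necessarily distinct) such that (q1) for every quantum homomorphism $Q:\mathbb R\to_q(A;S)$ there is a quantum homomorphism $Q':\mathbb G\to_q\mathbb A$ with $Q'_{g_i,a}=Q_{i,a}$ for all $i\in[r]$, $a\in A$; (q2) for every quantum homomorphism $Q:\mathbb G\to_q\mathbb A$, the quantum function $Q'_{i,a}:=Q_{g_i,a}$ is a quantum homomorphism $\mathbb R\to_q(A;S)$. $\mathbb A$ q-defines $\mathbb B$ if every relation of $\mathbb B$ has a q-definition in $\mathbb A$.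
   Formalization: Assumes additionally that all relations of B are non-empty, or that no element of the domain has its constant tuples in all relations of A; otherwise an empty relation of B is never q-definable although qPol(A) ⊆ qPol(B) can hold. *)

theory Defs
  imports "Jordan_Normal_Form.Schur_Decomposition"
begin

section \<open>Relational structures\<close>

text \<open>Tuples are lists, and coordinates are counted from \<open>0\<close>: the index set \<open>[r]\<close> is \<open>{..<r}\<close>.
  A structure carries its signature (the fields \<open>symbols\<close> and \<open>arity\<close>); two structures with the
  same type of symbols may still have different signatures.\<close>

record ('s, 'a) rel_structure =
  universe :: "'a set"
  symbols :: "'s set"
  arity :: "'s \<Rightarrow> nat"
  interp :: "'s \<Rightarrow> 'a list set"

definition tuples :: "'a set \<Rightarrow> nat \<Rightarrow> 'a list set" where
  "tuples A r = {xs. length xs = r \<and> set xs \<subseteq> A}"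

definition is_structure :: "('s, 'a) rel_structure \<Rightarrow> bool" where
  "is_structure \<AA> \<longleftrightarrow>
     finite (universe \<AA>) \<and> finite (symbols \<AA>) \<and>
     (\<forall>R\<in>symbols \<AA>. arity \<AA> R \<ge> 1 \<and> interp \<AA> R \<subseteq> tuples (universe \<AA>) (arity \<AA> R))"

definition same_signature :: "('s, 'a) rel_structure \<Rightarrow> ('s, 'b) rel_structure \<Rightarrow> bool" where
  "same_signature \<AA> \<BB> \<longleftrightarrow>
     symbols \<AA> = symbols \<BB> \<and> (\<forall>R\<in>symbols \<AA>. arity \<AA> R = arity \<BB> R)"

definition gaifman_edges :: "('s, 'a) rel_structure \<Rightarrow> 'a set set" where
  "gaifman_edges \<AA> =
     {{x, y} | x y. x \<noteq> y \<and> (\<exists>R\<in>symbols \<AA>. \<exists>t\<in>interp \<AA> R. x \<in> set t \<and> y \<in> set t)}"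

definition power_structure :: "('s, 'a) rel_structure \<Rightarrow> nat \<Rightarrow> ('s, 'a list) rel_structure" where
  "power_structure \<AA> n =
     \<lparr>universe = tuples (universe \<AA>) n,
      symbols = symbols \<AA>,
      arity = arity \<AA>,
      interp = (\<lambda>R. {bs \<in> tuples (tuples (universe \<AA>) n) (arity \<AA> R).
                       \<forall>i<n. map (\<lambda>b. b ! i) bs \<in> interp \<AA> R})\<rparr>"

definition single_relation :: "'a set \<Rightarrow> nat \<Rightarrow> 'a list set \<Rightarrow> (unit, 'a) rel_structure" where
  "single_relation A r S =
     \<lparr>universe = A, symbols = {()}, arity = (\<lambda>_. r), interp = (\<lambda>_. S)\<rparr>"

section \<open>Quantum homomorphisms\<close>

text \<open>The finite-dimensional Hilbert spaces are the spaces \<open>\<complex>\<^sup>d\<close>, and operators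
  are \<open>d \<times> d\<close> matrices; non-triviality is \<open>d \<ge> 1\<close>.  Since HOL functions are total, a
  quantum function from \<open>A\<close> to \<open>B\<close> is a function \<open>Q\<close> whose values \<open>Q a b\<close> matter
  only for \<open>a \<in> A\<close> and \<open>b \<in> B\<close>; no notion below depends on the other values.\<close>

definition projector :: "nat \<Rightarrow> complex mat \<Rightarrow> bool" where
  "projector d p \<longleftrightarrow> p \<in> carrier_mat d d \<and> mat_adjoint p = p \<and> p * p = p"

definition PVM :: "nat \<Rightarrow> 'b set \<Rightarrow> ('b \<Rightarrow> complex mat) \<Rightarrow> bool" where
  "PVM d B Q \<longleftrightarrow>
     (\<forall>b\<in>B. projector d (Q b)) \<and> finsum (ring_mat TYPE(complex) d ()) Q B = 1\<^sub>m d"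

definition quantum_function ::
    "nat \<Rightarrow> 'a set \<Rightarrow> 'b set \<Rightarrow> ('a \<Rightarrow> 'b \<Rightarrow> complex mat) \<Rightarrow> bool" where
  "quantum_function d A B Q \<longleftrightarrow> d \<ge> 1 \<and> (\<forall>a\<in>A. PVM d B (Q a))"

definition mat_prod_list :: "nat \<Rightarrow> complex mat list \<Rightarrow> complex mat" where
  "mat_prod_list d Ms = foldr (*) Ms (1\<^sub>m d)"

definition quantum_hom ::
    "nat \<Rightarrow> ('s, 'a) rel_structure \<Rightarrow> ('s, 'b) rel_structure \<Rightarrow> ('a \<Rightarrow> 'b \<Rightarrow> complex mat) \<Rightarrow> bool"
  where
  "quantum_hom d \<AA> \<BB> Q \<longleftrightarrow>
     quantum_function d (universe \<AA>) (universe \<BB>) Q \<and>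
     (\<forall>R\<in>symbols \<AA>. \<forall>as\<in>interp \<AA> R. \<forall>bs\<in>tuples (universe \<BB>) (arity \<AA> R) - interp \<BB> R.
        mat_prod_list d (map2 Q as bs) = 0\<^sub>m d d) \<and>
     (\<forall>a a'. {a, a'} \<in> gaifman_edges \<AA> \<longrightarrow>
        (\<forall>b\<in>universe \<BB>. \<forall>b'\<in>universe \<BB>. Q a b * Q a' b' = Q a' b' * Q a b))"

text \<open>An element of \<open>qPol \<AA>\<close> is recorded together with its arity \<open>n\<close> and the dimension \<open>d\<close> of
  its Hilbert space, neither of which can be read off from a total HOL function.\<close>

definition qPol :: "('s, 'a) rel_structure \<Rightarrow> (nat \<times> nat \<times> ('a list \<Rightarrow> 'a \<Rightarrow> complex mat)) set"
  where
  "qPol \<AA> = {(n, d, Q). n \<ge> 1 \<and> quantum_hom d (power_structure \<AA> n) \<AA> Q}"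

section \<open>Quantum definability\<close>

definition q_definition ::
    "('s, 'a) rel_structure \<Rightarrow> nat \<Rightarrow> 'a list set \<Rightarrow> ('s, 'g) rel_structure \<Rightarrow> 'g list \<Rightarrow> bool"
  where
  "q_definition \<AA> r S \<GG> gs \<longleftrightarrow>
     is_structure \<GG> \<and> same_signature \<GG> \<AA> \<and> gs \<in> tuples (universe \<GG>) r \<and>
     (let \<RR> = single_relation {..<r} r {[0..<r]};
          \<SS> = single_relation (universe \<AA>) r S
      in (\<forall>d Q. quantum_hom d \<RR> \<SS> Q \<longrightarrow>
            (\<exists>Q'. quantum_hom d \<GG> \<AA> Q' \<and>
                  (\<forall>i<r. \<forall>a\<in>universe \<AA>. Q' (gs ! i) a = Q i a))) \<and>
         (\<forall>d Q. quantum_hom d \<GG> \<AA> Q \<longrightarrow>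
            quantum_hom d \<RR> \<SS> (\<lambda>i a. Q (gs ! i) a)))"

text \<open>The defining structure \<open>\<GG>\<close> is finite, so up to isomorphism its vertices are natural
  numbers.  If \<open>S\<close> is empty there is no quantum homomorphism into \<open>(A; S)\<close>, so a
  q-definition of \<open>{}\<close> is a structure without quantum homomorphisms to \<open>\<AA>\<close>; it exists iff
  there is no \<open>a\<close> whose constant tuples lie in all relations of \<open>\<AA>\<close>.\<close>

definition q_defines :: "('s, 'a) rel_structure \<Rightarrow> ('t, 'a) rel_structure \<Rightarrow> bool" where
  "q_defines \<AA> \<BB> \<longleftrightarrow>
     (\<forall>R\<in>symbols \<BB>. \<exists>(\<GG> :: ('s, nat) rel_structure) gs.
        q_definition \<AA> (arity \<BB> R) (interp \<BB> R) \<GG> gs)"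

end

theory Submission
  imports Defs
begin

text \<open>If \<open>\<AA>\<close> q-defines a relation \<open>S\<close> by \<open>\<GG>\<close>, then \<open>n\<close> tuples of \<open>S\<close> are quantum homomorphisms of
  dimension one, and their extensions to \<open>\<GG>\<close> are classical homomorphisms \<open>\<GG> \<rightarrow> \<AA>\<close>; together they map
  \<open>\<GG>\<close> to \<open>\<AA>\<^sup>n\<close>. Composing with a quantum polymorphism of \<open>\<AA>\<close> and applying (q2) shows that it
  preserves \<open>S\<close>.

  Conversely, \<open>S = {s\<^sub>1, \<dots>, s\<^sub>n}\<close> is q-defined by \<open>\<AA>\<^sup>n\<close>, with the \<open>j\<close>-th distinguished vertex
  \<open>(s\<^sub>1 j, \<dots>, s\<^sub>n j)\<close>. Condition (q2) is preservation of \<open>S\<close> by quantum polymorphisms. For (q1), the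
  commuting PVMs \<open>Q 0, \<dots>, Q (r - 1)\<close> have a joint PVM \<open>P s = Q 0 (s 0) * \<dots> * Q (r - 1) (s (r - 1))\<close>
  supported on \<open>S\<close>, and its pushforwards along the coordinate maps \<open>s\<^sub>i \<mapsto> x i\<close>, for \<open>x \<in> A\<^sup>n\<close>, form
  a quantum polymorphism whose values at the distinguished vertices are the marginals \<open>Q j\<close>. If \<open>S\<close>
  is empty, then \<open>\<AA>\<^sup>0\<close> is a single vertex with all loops, and (q2) holds because it has no quantum
  homomorphism to \<open>\<AA>\<close>.\<close>

section \<open>Sums of square matrices and PVMs\<close>

abbreviation msum :: "nat \<Rightarrow> ('b \<Rightarrow> complex mat) \<Rightarrow> 'b set \<Rightarrow> complex mat" where
  "msum d \<equiv> finsum (ring_mat TYPE(complex) d ())"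

lemma mult_square_mat_closed [simp]:
  "M \<in> carrier_mat d d \<Longrightarrow> N \<in> carrier_mat d d \<Longrightarrow> M * N \<in> carrier_mat d d"
  by (rule mult_carrier_mat)

lemma msum_closed:
  assumes "\<And>b. b \<in> B \<Longrightarrow> f b \<in> carrier_mat d d"
  shows "msum d f B \<in> carrier_mat d d"
proof -
  interpret ring "ring_mat TYPE(complex) d ()" by (rule ring_mat)
  show ?thesis using finsum_closed[of f B] assms by (auto simp: ring_mat_simps)
qed

text \<open>Sums in the matrix ring are computed entrywise, so identities between them reduce to
  identities between sums of complex numbers. Most facts on \<open>msum\<close> below are obtained
  in this way.\<close>

lemma index_msum:
  assumes "finite B" "\<And>b. b \<in> B \<Longrightarrow> f b \<in> carrier_mat d d" "i < d" "j < d"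
  shows "msum d f B $$ (i, j) = (\<Sum>b\<in>B. f b $$ (i, j))"
  using assms(1,2)
proof (induction B)
  case empty
  interpret ring "ring_mat TYPE(complex) d ()" by (rule ring_mat)
  show ?case using finsum_empty assms(3,4) by (simp add: ring_mat_simps)
next
  case (insert b B)
  interpret ring "ring_mat TYPE(complex) d ()" by (rule ring_mat)
  have "msum d f (insert b B) = f b + msum d f B"
    using finsum_insert[of B b f] insert by (auto simp: ring_mat_simps)
  moreover have "msum d f B \<in> carrier_mat d d" using insert by (intro msum_closed) auto
  ultimately show ?case using insert assms(3,4) by simp
qed

lemma msum_eqI:
  assumes "finite B" "\<And>b. b \<in> B \<Longrightarrow> f b \<in> carrier_mat d d" "M \<in> carrier_mat d d"
    and "\<And>i j. i < d \<Longrightarrow> j < d \<Longrightarrow> (\<Sum>b\<in>B. f b $$ (i, j)) = M $$ (i, j)"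
  shows "msum d f B = M"
proof (rule eq_matI)
  have "msum d f B \<in> carrier_mat d d" using assms(2) by (rule msum_closed)
  then show "dim_row (msum d f B) = dim_row M" "dim_col (msum d f B) = dim_col M"
    using assms(3) by auto
qed (use assms index_msum[OF assms(1,2)] in auto)

lemma msum_cong:
  assumes "finite B" "\<And>b. b \<in> B \<Longrightarrow> f b \<in> carrier_mat d d" "\<And>b. b \<in> B \<Longrightarrow> f b = g b"
  shows "msum d f B = msum d g B"
  by (rule msum_eqI) (use assms in \<open>auto simp: index_msum intro!: msum_closed\<close>)

lemma msum_zero:
  assumes "finite B" "\<And>b. b \<in> B \<Longrightarrow> f b = 0\<^sub>m d d"
  shows "msum d f B = 0\<^sub>m d d"
  by (rule msum_eqI) (use assms in auto)

lemma msum_reindex_bij_betw: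
  assumes "finite A" "bij_betw h A B" "\<And>b. b \<in> B \<Longrightarrow> f b \<in> carrier_mat d d"
  shows "msum d (\<lambda>a. f (h a)) A = msum d f B"
proof -
  have B: "finite B" "\<And>a. a \<in> A \<Longrightarrow> h a \<in> B"
    using assms(1,2) by (auto simp: bij_betw_def)
  show ?thesis
  proof (rule msum_eqI)
    fix i j assume ij: "i < d" "j < d"
    show "(\<Sum>a\<in>A. f (h a) $$ (i, j)) = msum d f B $$ (i, j)"
      using B assms(3) ij sum.reindex_bij_betw[OF assms(2), of "\<lambda>b. f b $$ (i, j)"]
      by (simp add: index_msum)
  qed (use assms B in \<open>auto intro!: msum_closed\<close>)
qed

lemma msum_restrict:
  assumes "finite B" "A \<subseteq> B" "\<And>b. b \<in> B \<Longrightarrow> f b \<in> carrier_mat d d"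
    and "\<And>b. b \<in> B - A \<Longrightarrow> f b = 0\<^sub>m d d"
  shows "msum d f A = msum d f B"
proof (rule msum_eqI)
  fix i j assume ij: "i < d" "j < d"
  show "(\<Sum>b\<in>A. f b $$ (i, j)) = msum d f B $$ (i, j)"
    using assms ij by (simp add: index_msum) (intro sum.mono_neutral_left ballI, auto)
qed (use assms in \<open>auto intro: finite_subset intro!: msum_closed\<close>)

lemma mult_msum:
  assumes "finite B" "\<And>b. b \<in> B \<Longrightarrow> f b \<in> carrier_mat d d" "M \<in> carrier_mat d d"
  shows "M * msum d f B = msum d (\<lambda>b. M * f b) B"
proof -
  interpret ring "ring_mat TYPE(complex) d ()" by (rule ring_mat)
  show ?thesis using finsum_rdistr[of B M f] assms by (auto simp: ring_mat_simps Pi_def)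
qed

lemma msum_mult:
  assumes "finite B" "\<And>b. b \<in> B \<Longrightarrow> f b \<in> carrier_mat d d" "M \<in> carrier_mat d d"
  shows "msum d f B * M = msum d (\<lambda>b. f b * M) B"
proof -
  interpret ring "ring_mat TYPE(complex) d ()" by (rule ring_mat)
  show ?thesis using finsum_ldistr[of B M f] assms by (auto simp: ring_mat_simps Pi_def)
qed

lemma msum_commute:
  assumes "finite B" "\<And>b. b \<in> B \<Longrightarrow> f b \<in> carrier_mat d d" "M \<in> carrier_mat d d"
    and "\<And>b. b \<in> B \<Longrightarrow> M * f b = f b * M"
  shows "M * msum d f B = msum d f B * M"
proof -
  have "M * msum d f B = msum d (\<lambda>b. M * f b) B" using assms(1-3) by (rule mult_msum)
  also have "\<dots> = msum d (\<lambda>b. f b * M) B"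
    by (rule msum_cong[OF assms(1) _ assms(4)]) (simp_all add: assms(2,3))
  also have "\<dots> = msum d f B * M" using assms(1-3) by (rule msum_mult[symmetric])
  finally show ?thesis .
qed

section \<open>Adjoints of square complex matrices\<close>

lemma dim_mat_adjoint [simp]:
  "dim_row (mat_adjoint M) = dim_col M" "dim_col (mat_adjoint M) = dim_row M"
  by (simp_all add: mat_adjoint_def)

lemma mat_adjoint_closed [simp]:
  "M \<in> carrier_mat n m \<Longrightarrow> mat_adjoint M \<in> carrier_mat m n"
  by (intro carrier_matI) simp_all

lemma index_mat_adjoint [simp]:
  assumes "i < dim_col M" "j < dim_row M"
  shows "mat_adjoint M $$ (i, j) = conjugate (M $$ (j, i))"
  using assms by (simp add: mat_adjoint_def mat_of_rows_index)

lemma mat_adjoint_mult: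
  fixes M N :: "complex mat"
  assumes "M \<in> carrier_mat d d" "N \<in> carrier_mat d d"
  shows "mat_adjoint (M * N) = mat_adjoint N * mat_adjoint M"
  by (rule eq_matI) (use assms in \<open>auto simp: scalar_prod_def mult.commute intro!: sum.cong\<close>)

text \<open>The diagonal entry is the squared norm of column \<open>j\<close>. Hence it is a
  nonnegative real, and it vanishes only if the whole column does, which is how orthogonality of
  PVMs is obtained.\<close>

lemma diag_mat_adjoint_mult_self:
  fixes M :: "complex mat"
  assumes "M \<in> carrier_mat d d" "j < d"
  shows "(mat_adjoint M * M) $$ (j, j) = of_real (\<Sum>k<d. (cmod (M $$ (k, j)))\<^sup>2)"
proof -
  have "(mat_adjoint M * M) $$ (j, j) = (\<Sum>k<d. cnj (M $$ (k, j)) * M $$ (k, j))"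
    using assms by (simp add: scalar_prod_def atLeast0LessThan)
  also have "\<dots> = of_real (\<Sum>k<d. (cmod (M $$ (k, j)))\<^sup>2)"
    by (simp only: of_real_sum complex_norm_square mult.commute)
  finally show ?thesis .
qed

section \<open>Orthogonality and pushforwards of PVMs\<close>

lemma PVM_carrier: "PVM d B Q \<Longrightarrow> b \<in> B \<Longrightarrow> Q b \<in> carrier_mat d d"
  by (simp add: PVM_def projector_def)

lemma PVM_idem: "PVM d B Q \<Longrightarrow> b \<in> B \<Longrightarrow> Q b * Q b = Q b"
  by (simp add: PVM_def projector_def)

text \<open>The matrices \<open>(Q c * Q b)\<^sup>* * (Q c * Q b) = Q b * Q c * Q b\<close> have nonnegative diagonals, they
  add up to \<open>Q b\<close> over all \<open>c\<close>, and the term \<open>c = b\<close> is already \<open>Q b\<close>.\<close>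
lemma PVM_orthogonal:
  assumes "finite B" "PVM d B Q" "b \<in> B" "c \<in> B" "b \<noteq> c"
  shows "Q c * Q b = 0\<^sub>m d d"
proof -
  note Q = PVM_carrier[OF assms(2)]
  have sandwich: "mat_adjoint (Q x * Q b) * (Q x * Q b) = Q b * (Q x * Q b)" if "x \<in> B" for x
  proof -
    have "mat_adjoint (Q x * Q b) = Q b * Q x"
      using assms(2,3) that mat_adjoint_mult[OF Q Q] by (simp add: PVM_def projector_def)
    then have "mat_adjoint (Q x * Q b) * (Q x * Q b) = Q b * ((Q x * Q x) * Q b)"
      using Q[OF that] Q[OF assms(3)] by (simp add: assoc_mult_mat[of _ d d _ d _ d])
    then show ?thesis using PVM_idem[OF assms(2) that] by simp
  qed
  have total: "msum d (\<lambda>x. Q b * (Q x * Q b)) B = Q b"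
  proof -
    have "Q b * (msum d Q B * Q b) = Q b"
      using assms(2,3) Q[OF assms(3)] PVM_idem[OF assms(2,3)] by (simp add: PVM_def)
    moreover have "msum d Q B * Q b = msum d (\<lambda>x. Q x * Q b) B"
      using assms(1,3) Q by (intro msum_mult)
    moreover have "Q b * msum d (\<lambda>x. Q x * Q b) B = msum d (\<lambda>x. Q b * (Q x * Q b)) B"
      using assms(1,3) Q by (intro mult_msum) auto
    ultimately show ?thesis by simp
  qed
  have "(Q c * Q b) $$ (k, j) = 0" if kj: "k < d" "j < d" for k j
  proof -
    define N where "N x = (\<Sum>k<d. (cmod ((Q x * Q b) $$ (k, j)))\<^sup>2)" for x
    have N: "of_real (N x) = (Q b * (Q x * Q b)) $$ (j, j)" if "x \<in> B" for x
      unfolding N_def sandwich[OF that, symmetric]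
      using Q[OF that] Q[OF assms(3)] kj by (intro diag_mat_adjoint_mult_self[symmetric]) auto
    have "complex_of_real (\<Sum>x\<in>B. N x) = msum d (\<lambda>x. Q b * (Q x * Q b)) B $$ (j, j)"
      using N Q assms(1,3) kj by (simp add: index_msum)
    also have "\<dots> = of_real (N b)"
      using N[OF assms(3)] PVM_idem[OF assms(2,3)] total by simp
    finally have "(\<Sum>x\<in>B. N x) = N b" using of_real_eq_iff by blast
    then have "(\<Sum>x\<in>B - {b}. N x) = 0" using assms(1,3) by (simp add: sum_diff1)
    moreover have "\<And>x. N x \<ge> 0" unfolding N_def by (simp add: sum_nonneg)
    ultimately have "N c = 0" using assms by (subst (asm) sum_nonneg_eq_0_iff) auto
    then show ?thesis unfolding N_def using kj by (subst (asm) sum_nonneg_eq_0_iff) auto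
  qed
  then show ?thesis using Q[OF assms(3)] Q[OF assms(4)] by (intro eq_matI) auto
qed

lemma PVM_mult:
  assumes "finite B" "PVM d B Q" "b \<in> B" "c \<in> B"
  shows "Q b * Q c = (if b = c then Q c else 0\<^sub>m d d)"
  using PVM_orthogonal[OF assms(1,2,4,3)] PVM_idem[OF assms(2,4)] by auto

text \<open>The sum over \<open>C\<close> is the projector of the event that the outcome lies in
  \<open>C\<close>; by orthogonality, at most the term \<open>c = b\<close> survives the
  multiplication by \<open>Q b\<close>.\<close>

lemma PVM_mult_msum:
  assumes "finite B" "PVM d B Q" "b \<in> B" "C \<subseteq> B"
  shows "Q b * msum d Q C = (if b \<in> C then Q b else 0\<^sub>m d d)"
proof -
  have C: "finite C" "\<And>c. c \<in> C \<Longrightarrow> Q c \<in> carrier_mat d d"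
    using assms PVM_carrier[OF assms(2)] by (auto intro: finite_subset)
  note Q = PVM_carrier[OF assms(2)]
  have "msum d (\<lambda>c. Q b * Q c) C = (if b \<in> C then Q b else 0\<^sub>m d d)"
  proof (rule msum_eqI)
    fix i j assume ij: "i < d" "j < d"
    have "(\<Sum>c\<in>C. (Q b * Q c) $$ (i, j)) = (\<Sum>c\<in>C. if b = c then Q c $$ (i, j) else 0)"
      using assms ij by (intro sum.cong) (auto simp: PVM_mult[OF assms(1-3)])
    then show "(\<Sum>c\<in>C. (Q b * Q c) $$ (i, j)) = (if b \<in> C then Q b else 0\<^sub>m d d) $$ (i, j)"
      using C ij by simp
  qed (use C Q[OF assms(3)] in auto)
  then show ?thesis using C Q[OF assms(3)] by (simp add: mult_msum)
qed

text \<open>This is the pushforward of a PVM along \<open>f\<close>. A fibre sum is idempotent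
  because each \<open>P i\<close> with \<open>i\<close> in the fibre satisfies
  \<open>P i * msum d P (J b) = P i\<close>, and the total is the identity because the fibres over
  \<open>B\<close> partition \<open>I\<close>.\<close>

lemma PVM_coarsen:
  assumes "finite I" "finite B" "PVM d I P" "\<And>i. i \<in> I \<Longrightarrow> f i \<in> B"
  shows "PVM d B (\<lambda>b. msum d P {i \<in> I. f i = b})"
proof -
  note P = PVM_carrier[OF assms(3)]
  define J where "J b = {i \<in> I. f i = b}" for b
  have J: "finite (J b)" "J b \<subseteq> I" "\<And>i. i \<in> J b \<Longrightarrow> P i \<in> carrier_mat d d" for b
    using assms(1) P by (auto simp: J_def)
  have c: "msum d P (J b) \<in> carrier_mat d d" for b using J by (intro msum_closed)
  have "projector d (msum d P (J b))" for b
    unfolding projector_def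
  proof (intro conjI)
    \<comment> \<open>Conjugation is additive, so self-adjointness passes entrywise from the
      \<open>P x\<close> to their sum.\<close>
    show "mat_adjoint (msum d P (J b)) = msum d P (J b)"
    proof (rule eq_matI)
      fix i j assume "i < dim_row (msum d P (J b))" "j < dim_col (msum d P (J b))"
      then have ij: "i < d" "j < d" using c[of b] by auto
      have "cnj (P x $$ (j, i)) = P x $$ (i, j)" if "x \<in> J b" for x
      proof -
        have "mat_adjoint (P x) = P x" "P x \<in> carrier_mat d d"
          using J(2) that assms(3) by (auto simp: PVM_def projector_def)
        then show ?thesis using index_mat_adjoint[of i "P x" j] ij by simp
      qed
      then show "mat_adjoint (msum d P (J b)) $$ (i, j) = msum d P (J b) $$ (i, j)"
        using ij J by (simp add: carrier_matD[OF c] index_msum)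
    qed (use c[of b] in auto)
    have "msum d P (J b) * msum d P (J b) = msum d (\<lambda>i. P i * msum d P (J b)) (J b)"
      using J c by (simp add: msum_mult)
    also have "\<dots> = msum d P (J b)"
    proof (rule msum_cong)
      fix i assume "i \<in> J b"
      then have "i \<in> I" using J(2) by blast
      show eq: "P i * msum d P (J b) = P i"
        using PVM_mult_msum[OF assms(1,3) \<open>i \<in> I\<close> J(2)] \<open>i \<in> J b\<close> by simp
      show "P i * msum d P (J b) \<in> carrier_mat d d" unfolding eq by (rule P[OF \<open>i \<in> I\<close>])
    qed (rule J)
    finally show "msum d P (J b) * msum d P (J b) = msum d P (J b)" .
  qed (rule c)
  moreover have "msum d (\<lambda>b. msum d P (J b)) B = 1\<^sub>m d"
  proof (rule msum_eqI)
    fix i j assume ij: "i < d" "j < d"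
    have "(\<Sum>b\<in>B. msum d P (J b) $$ (i, j)) = (\<Sum>b\<in>B. \<Sum>x\<in>J b. P x $$ (i, j))"
      using ij J by (simp add: index_msum)
    also have "\<dots> = (\<Sum>x\<in>I. P x $$ (i, j))"
      unfolding J_def using assms by (intro sum.group) auto
    also have "\<dots> = msum d P I $$ (i, j)" using assms(1) P ij by (simp add: index_msum)
    finally show "(\<Sum>b\<in>B. msum d P (J b) $$ (i, j)) = 1\<^sub>m d $$ (i, j)"
      using assms(3) by (simp add: PVM_def)
  qed (use assms c in auto)
  ultimately show ?thesis unfolding J_def PVM_def by simp
qed

section \<open>Products of lists of commuting matrices\<close>

lemma mat_prod_list_simps [simp]:
  "mat_prod_list d [] = 1\<^sub>m d"
  "mat_prod_list d (M # Ms) = M * mat_prod_list d Ms"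
  by (simp_all add: mat_prod_list_def)

lemma mat_prod_list_closed:
  assumes "set Ms \<subseteq> carrier_mat d d"
  shows "mat_prod_list d Ms \<in> carrier_mat d d"
  using assms by (induction Ms) auto

lemma mat_prod_list_commute:
  assumes "M \<in> carrier_mat d d" "set Ms \<subseteq> carrier_mat d d" "\<And>X. X \<in> set Ms \<Longrightarrow> M * X = X * M"
  shows "M * mat_prod_list d Ms = mat_prod_list d Ms * M"
  using assms(2,3)
proof (induction Ms)
  case (Cons X Ms)
  have c: "mat_prod_list d Ms \<in> carrier_mat d d" using Cons by (intro mat_prod_list_closed) auto
  have "M * (X * mat_prod_list d Ms) = X * M * mat_prod_list d Ms"
    using Cons c assms(1) by (simp add: assoc_mult_mat[of _ d d _ d _ d, symmetric])
  also have "\<dots> = X * mat_prod_list d Ms * M"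
    using Cons c assms(1) by (simp add: assoc_mult_mat[of _ d d _ d _ d])
  finally show ?case by simp
qed (use assms(1) in simp)

text \<open>\<open>M\<close> is moved to the right until it meets the factor \<open>X\<close>, on
  which it acts as the scalar \<open>c\<close>, and the scalar is then pulled out. The case
  \<open>c = 0\<close> says that \<open>M\<close> annihilates the product, the case
  \<open>c = 1\<close> that the product absorbs \<open>M\<close>.\<close>

lemma mult_mat_prod_list_eq_smult:
  assumes "M \<in> carrier_mat d d" "set Ms \<subseteq> carrier_mat d d" "\<And>X. X \<in> set Ms \<Longrightarrow> M * X = X * M"
    and "X \<in> set Ms" "M * X = c \<cdot>\<^sub>m X"
  shows "M * mat_prod_list d Ms = c \<cdot>\<^sub>m mat_prod_list d Ms"
  using assms(2-4)
proof (induction Ms)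
  case (Cons Y Ms)
  have p: "mat_prod_list d Ms \<in> carrier_mat d d" using Cons by (intro mat_prod_list_closed) auto
  have Y: "Y \<in> carrier_mat d d" using Cons by auto
  show ?case
  proof (cases "Y = X")
    case True
    then have "M * (Y * mat_prod_list d Ms) = (c \<cdot>\<^sub>m Y) * mat_prod_list d Ms"
      using assms(1,5) p Y by (simp add: assoc_mult_mat[of _ d d _ d _ d, symmetric])
    then show ?thesis using p Y by (simp add: mult_smult_assoc_mat[of _ d d _ d])
  next
    case False
    have "M * (Y * mat_prod_list d Ms) = M * Y * mat_prod_list d Ms"
      using assms(1) p Y by (simp add: assoc_mult_mat[of _ d d _ d _ d])
    also have "M * Y = Y * M" using Cons.prems(2)[of Y] by simp
    also have "Y * M * mat_prod_list d Ms = Y * (M * mat_prod_list d Ms)"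
      using assms(1) p Y by (simp add: assoc_mult_mat[of _ d d _ d _ d])
    also have "M * mat_prod_list d Ms = c \<cdot>\<^sub>m mat_prod_list d Ms"
      using Cons False by auto
    finally show ?thesis using p Y by (simp add: mult_smult_distrib[of _ d d _ d])
  qed
qed simp

lemma mult_mat_prod_list_eq_zero:
  assumes "M \<in> carrier_mat d d" "set Ms \<subseteq> carrier_mat d d" "\<And>X. X \<in> set Ms \<Longrightarrow> M * X = X * M"
    and "X \<in> set Ms" "M * X = 0\<^sub>m d d"
  shows "M * mat_prod_list d Ms = 0\<^sub>m d d"
proof -
  have zero: "0 \<cdot>\<^sub>m Y = 0\<^sub>m d d" if "Y \<in> carrier_mat d d" for Y :: "complex mat"
    using that by (intro eq_matI) auto
  have "M * X = 0 \<cdot>\<^sub>m X" using assms zero[of X] by auto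
  then show ?thesis
    using mult_mat_prod_list_eq_smult[OF assms(1-4)] zero[OF mat_prod_list_closed[OF assms(2)]] by simp
qed

lemma mult_mat_prod_list_absorb:
  assumes "M \<in> carrier_mat d d" "set Ms \<subseteq> carrier_mat d d" "\<And>X. X \<in> set Ms \<Longrightarrow> M * X = X * M"
    and "X \<in> set Ms" "M * X = X"
  shows "M * mat_prod_list d Ms = mat_prod_list d Ms"
proof -
  have one: "1 \<cdot>\<^sub>m Y = Y" for Y :: "complex mat" by (intro eq_matI) auto
  show ?thesis using mult_mat_prod_list_eq_smult[OF assms(1-4), of 1] assms(5) by (simp add: one)
qed

lemma projector_mult:
  assumes "projector d p" "projector d q" "p * q = q * p"
  shows "projector d (p * q)"
proof -
  have c: "p \<in> carrier_mat d d" "q \<in> carrier_mat d d" using assms by (auto simp: projector_def)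
  have "p * q * (p * q) = p * (q * p) * q" using c by (simp add: assoc_mult_mat[of _ d d _ d _ d])
  also have "\<dots> = (p * p) * (q * q)"
    using c unfolding assms(3)[symmetric] by (simp add: assoc_mult_mat[of _ d d _ d _ d])
  finally show ?thesis using assms c mat_adjoint_mult[OF c] by (auto simp: projector_def)
qed

section \<open>Joint PVMs of commuting PVMs\<close>

lemma finite_tuples: "finite A \<Longrightarrow> finite (tuples A r)"
  using finite_lists_length_eq[of A r] by (simp add: tuples_def conj_commute)

lemma tuples_Suc: "tuples A (Suc r) = (\<lambda>(b, s). b # s) ` (A \<times> tuples A r)"
  by (auto simp: tuples_def length_Suc_conv)

lemma tuples_nth: "s \<in> tuples A r \<Longrightarrow> i < r \<Longrightarrow> s ! i \<in> A"
  by (auto simp: tuples_def)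

lemma set_map2E:
  assumes "X \<in> set (map2 f xs ys)"
  obtains x y where "x \<in> set xs" "y \<in> set ys" "X = f x y"
  using assms by (auto dest: set_zip_leftD set_zip_rightD)

lemma set_map2I:
  assumes "i < length xs" "i < length ys"
  shows "f (xs ! i) (ys ! i) \<in> set (map2 f xs ys)"
  using assms nth_mem[of i "map2 f xs ys"] by simp

lemma map2_carrier:
  assumes "\<And>i. i \<in> set xs \<Longrightarrow> PVM d B (Q i)" "set s \<subseteq> B"
  shows "set (map2 Q xs s) \<subseteq> carrier_mat d d"
proof
  fix X assume "X \<in> set (map2 Q xs s)"
  then obtain i b where "i \<in> set xs" "b \<in> set s" "X = Q i b" by (rule set_map2E)
  then show "X \<in> carrier_mat d d" using PVM_carrier[OF assms(1)] assms(2) by auto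
qed

text \<open>This is the joint measurement of commuting PVMs, built one measurement at a time.
  Commutation makes each product a projector, and the sum over all outcome tuples factors into the
  total of the first PVM and the total of the joint PVM of the rest.\<close>

lemma PVM_mat_prod_list:
  assumes "finite B" "\<And>i. i \<in> set xs \<Longrightarrow> PVM d B (Q i)"
    and "\<And>i j b c. i \<in> set xs \<Longrightarrow> j \<in> set xs \<Longrightarrow> b \<in> B \<Longrightarrow> c \<in> B \<Longrightarrow> Q i b * Q j c = Q j c * Q i b"
  shows "PVM d (tuples B (length xs)) (\<lambda>s. mat_prod_list d (map2 Q xs s))"
  using assms(2,3)
proof (induction xs)
  case Nil
  have t: "tuples B 0 = {[]}" by (auto simp: tuples_def)
  have 1: "mat_adjoint (1\<^sub>m d :: complex mat) = 1\<^sub>m d"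
    by (intro eq_matI) auto
  have "msum d (\<lambda>s. mat_prod_list d (map2 Q [] s)) {[]} = 1\<^sub>m d"
    by (rule msum_eqI) auto
  with 1 show ?case unfolding PVM_def projector_def by (auto simp: t)
next
  case (Cons x xs)
  define P where "P s = mat_prod_list d (map2 Q xs s)" for s
  have P: "PVM d (tuples B (length xs)) P"
    unfolding P_def using Cons by simp
  note cP = PVM_carrier[OF P]
  have Qx: "PVM d B (Q x)" using Cons by simp
  note cQ = PVM_carrier[OF Qx]
  note fin = finite_tuples[OF assms(1)]
  \<comment> \<open>\<open>Q x b\<close> commutes with every factor of \<open>P s\<close>, hence
    with \<open>P s\<close> itself.\<close>
  have "projector d (Q x b * P s)" if "b \<in> B" "s \<in> tuples B (length xs)" for b s
  proof (rule projector_mult)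
    have "set s \<subseteq> B" using that by (auto simp: tuples_def)
    then show "Q x b * P s = P s * Q x b"
      unfolding P_def
    proof (intro mat_prod_list_commute map2_carrier cQ)
      fix X assume "X \<in> set (map2 Q xs s)"
      then obtain i c where "i \<in> set xs" "c \<in> set s" "X = Q i c" by (rule set_map2E)
      then show "Q x b * X = X * Q x b"
        using Cons.prems(2)[of x i b c] \<open>set s \<subseteq> B\<close> that by auto
    qed (use Cons.prems that \<open>set s \<subseteq> B\<close> in auto)
  qed (use that P Qx in \<open>auto simp: PVM_def\<close>)
  moreover have "msum d (\<lambda>s. mat_prod_list d (map2 Q (x # xs) s)) (tuples B (Suc (length xs))) = 1\<^sub>m d"
  proof (rule msum_eqI)
    fix i j assume ij: "i < d" "j < d"
    \<comment> \<open>An outcome tuple is split into its head \<open>b\<close> and its tail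
      \<open>s\<close>. Summing over \<open>s\<close> first gives the identity by induction, and the
      sum over \<open>b\<close> is the total of \<open>Q x\<close>.\<close>
    have "(\<Sum>s\<in>tuples B (Suc (length xs)). mat_prod_list d (map2 Q (x # xs) s) $$ (i, j)) =
      (\<Sum>(b, s)\<in>B \<times> tuples B (length xs). (Q x b * P s) $$ (i, j))"
      unfolding tuples_Suc P_def by (subst sum.reindex) (auto simp: inj_on_def intro!: sum.cong)
    also have "\<dots> = (\<Sum>b\<in>B. msum d (\<lambda>s. Q x b * P s) (tuples B (length xs)) $$ (i, j))"
      using ij fin cP cQ by (simp add: sum.cartesian_product[symmetric] index_msum)
    also have "\<dots> = (\<Sum>b\<in>B. (Q x b * msum d P (tuples B (length xs))) $$ (i, j))"
      using fin cP cQ by (simp add: mult_msum)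
    also have "\<dots> = (\<Sum>b\<in>B. Q x b $$ (i, j))"
      using P right_mult_one_mat[OF cQ] by (simp add: PVM_def)
    also have "\<dots> = msum d (Q x) B $$ (i, j)" using cQ ij assms(1) by (simp add: index_msum)
    also have "\<dots> = 1\<^sub>m d $$ (i, j)" using Qx by (simp add: PVM_def)
    finally show "(\<Sum>s\<in>tuples B (Suc (length xs)). mat_prod_list d (map2 Q (x # xs) s) $$ (i, j)) =
      1\<^sub>m d $$ (i, j)" .
  next
    fix s assume "s \<in> tuples B (Suc (length xs))"
    then show "mat_prod_list d (map2 Q (x # xs) s) \<in> carrier_mat d d"
      using Cons.prems by (intro mat_prod_list_closed map2_carrier) (auto simp: tuples_def)
  qed (use fin in auto)
  ultimately show ?case unfolding PVM_def by (auto simp: tuples_Suc P_def)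
qed

lemma PVM_reindex:
  assumes "finite I" "bij_betw h I S" "PVM d S P"
  shows "PVM d I (\<lambda>i. P (h i))"
  using assms msum_reindex_bij_betw[OF assms(1,2), of P d] PVM_carrier[OF assms(3)]
  unfolding PVM_def by (auto dest: bij_betwE)

lemma PVM_subset:
  assumes "finite B" "PVM d B Q" "S \<subseteq> B" "\<And>b. b \<in> B - S \<Longrightarrow> Q b = 0\<^sub>m d d"
  shows "PVM d S Q"
  using assms msum_restrict[OF assms(1,3), of Q d] PVM_carrier[OF assms(2)]
  unfolding PVM_def by auto

lemma PVM_commute:
  assumes "finite B" "PVM d B Q" "b \<in> B" "c \<in> B"
  shows "Q b * Q c = Q c * Q b"
  using PVM_mult[OF assms] PVM_mult[OF assms(1,2,4,3)] by auto

section \<open>Quantum homomorphisms\<close>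

lemma doubleton_in_gaifman_edges:
  "{a, a'} \<in> gaifman_edges \<AA> \<longleftrightarrow>
    a \<noteq> a' \<and> (\<exists>R\<in>symbols \<AA>. \<exists>t\<in>interp \<AA> R. a \<in> set t \<and> a' \<in> set t)"
  unfolding gaifman_edges_def by (auto simp: doubleton_eq_iff)

text \<open>Edges of the Gaifman graph join distinct vertices, but the projectors of a single PVM
  commute anyway. So (QH2) may be stated as commutation within each tuple, repeated entries
  included, and both conditions can be checked tuple by tuple.\<close>

lemma quantum_hom_iff:
  assumes "finite (universe \<BB>)" "\<forall>R\<in>symbols \<AA>. \<forall>t\<in>interp \<AA> R. set t \<subseteq> universe \<AA>"
  shows "quantum_hom d \<AA> \<BB> Q \<longleftrightarrow>
    quantum_function d (universe \<AA>) (universe \<BB>) Q \<and>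
    (\<forall>R\<in>symbols \<AA>. \<forall>t\<in>interp \<AA> R.
      (\<forall>bs\<in>tuples (universe \<BB>) (arity \<AA> R) - interp \<BB> R. mat_prod_list d (map2 Q t bs) = 0\<^sub>m d d) \<and>
      (\<forall>x\<in>set t. \<forall>y\<in>set t. \<forall>b\<in>universe \<BB>. \<forall>c\<in>universe \<BB>. Q x b * Q y c = Q y c * Q x b))"
    (is "_ \<longleftrightarrow> ?F \<and> ?C")
proof
  assume Q: "quantum_hom d \<AA> \<BB> Q"
  then have F: ?F by (simp add: quantum_hom_def)
  have "Q x b * Q y c = Q y c * Q x b"
    if "R \<in> symbols \<AA>" "t \<in> interp \<AA> R" "x \<in> set t" "y \<in> set t" "b \<in> universe \<BB>" "c \<in> universe \<BB>"
    for R t x y b c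
  proof (cases "x = y")
    case True
    have "PVM d (universe \<BB>) (Q x)"
      using F assms(2) that unfolding quantum_function_def by blast
    then show ?thesis using PVM_commute[OF assms(1)] that True by blast
  next
    case False
    then have "{x, y} \<in> gaifman_edges \<AA>" unfolding doubleton_in_gaifman_edges using that by blast
    then show ?thesis using Q that unfolding quantum_hom_def by blast
  qed
  with Q F show "?F \<and> ?C" unfolding quantum_hom_def by blast
next
  assume "?F \<and> ?C"
  then show "quantum_hom d \<AA> \<BB> Q"
    unfolding quantum_hom_def doubleton_in_gaifman_edges by blast
qed

lemma quantum_hom_single_iff:
  assumes "finite A"
  shows "quantum_hom d (single_relation {..<r} r {[0..<r]}) (single_relation A r S) Q \<longleftrightarrow>
    d \<ge> 1 \<and> (\<forall>i<r. PVM d A (Q i)) \<and>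
    (\<forall>bs\<in>tuples A r - S. mat_prod_list d (map2 Q [0..<r] bs) = 0\<^sub>m d d) \<and>
    (\<forall>i<r. \<forall>j<r. \<forall>b\<in>A. \<forall>c\<in>A. Q i b * Q j c = Q j c * Q i b)"
  by (subst quantum_hom_iff)
    (auto simp: single_relation_def quantum_function_def assms atLeast0LessThan)

text \<open>This exchanges descriptions such as \<open>map g [0..<r] ! i\<close> and
  \<open>g i\<close>, which are known to agree only for \<open>i < r\<close>.\<close>

lemma single_quantum_hom_cong:
  assumes "quantum_hom d (single_relation {..<r} r {[0..<r]}) (single_relation A r S) Q"
    and "finite A" "\<And>i. i < r \<Longrightarrow> Q i = Q' i"
  shows "quantum_hom d (single_relation {..<r} r {[0..<r]}) (single_relation A r S) Q'"
proof -
  have "map2 Q [0..<r] bs = map2 Q' [0..<r] bs" for bs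
    using assms(3) by (intro map_cong) (auto dest: set_zip_leftD)
  then have "(\<lambda>bs. map2 Q [0..<r] bs) = (\<lambda>bs. map2 Q' [0..<r] bs)" by (rule ext)
  then show ?thesis
    using assms(1,3) unfolding quantum_hom_single_iff[OF assms(2)] by metis
qed

section \<open>Powers of structures and composition with classical homomorphisms\<close>

lemma structure_tuple:
  assumes "is_structure \<AA>" "R \<in> symbols \<AA>" "t \<in> interp \<AA> R"
  shows "length t = arity \<AA> R" "set t \<subseteq> universe \<AA>"
  using assms unfolding is_structure_def tuples_def by blast+

lemma structure_tuples:
  "is_structure \<AA> \<Longrightarrow> \<forall>R\<in>symbols \<AA>. \<forall>t\<in>interp \<AA> R. set t \<subseteq> universe \<AA>"
  by (intro ballI) (rule structure_tuple(2))

lemma power_structure_simps [simp]: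
  "universe (power_structure \<AA> n) = tuples (universe \<AA>) n"
  "symbols (power_structure \<AA> n) = symbols \<AA>"
  "arity (power_structure \<AA> n) = arity \<AA>"
  by (simp_all add: power_structure_def)

lemma interp_power_structure:
  "bs \<in> interp (power_structure \<AA> n) R \<longleftrightarrow>
    bs \<in> tuples (tuples (universe \<AA>) n) (arity \<AA> R) \<and> (\<forall>i<n. map (\<lambda>b. b ! i) bs \<in> interp \<AA> R)"
  by (simp add: power_structure_def)

lemma is_structure_power: "is_structure \<AA> \<Longrightarrow> is_structure (power_structure \<AA> n)"
  unfolding is_structure_def by (auto simp: finite_tuples interp_power_structure)

lemma same_signature_power: "same_signature (power_structure \<AA> n) \<AA>"
  by (simp add: same_signature_def)

lemma map2_map_left: "map2 f (map h xs) ys = map2 (\<lambda>x. f (h x)) xs ys"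
  by (simp add: zip_map1 split_def)

lemma map2_nth_left:
  assumes "length t = r"
  shows "map2 f t ys = map2 (\<lambda>i. f (t ! i)) [0..<r] ys"
proof -
  have "map ((!) t) [0..<r] = t" using map_nth[of t] assms by simp
  then show ?thesis using map2_map_left[of f "(!) t" "[0..<r]" ys] by simp
qed

text \<open>\<open>h\<close> is a classical homomorphism from \<open>\<GG>\<close> to
  \<open>\<AA>\<close>, so the conditions at a tuple \<open>t\<close> of \<open>\<GG>\<close> are
  those at the tuple \<open>map h t\<close> of \<open>\<AA>\<close>. Since commutation is stated per
  tuple, it does no harm if \<open>h\<close> identifies adjacent vertices.\<close>

lemma quantum_hom_comp:
  assumes "quantum_hom d \<AA> \<BB> Q" "is_structure \<GG>" "is_structure \<AA>" "finite (universe \<BB>)"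
    and "same_signature \<GG> \<AA>" "\<And>g. g \<in> universe \<GG> \<Longrightarrow> h g \<in> universe \<AA>"
    and "\<And>R t. R \<in> symbols \<GG> \<Longrightarrow> t \<in> interp \<GG> R \<Longrightarrow> map h t \<in> interp \<AA> R"
  shows "quantum_hom d \<GG> \<BB> (\<lambda>g. Q (h g))"
proof -
  note Q = assms(1)[unfolded quantum_hom_iff[OF assms(4) structure_tuples[OF assms(3)]]]
  have sig: "symbols \<GG> = symbols \<AA>" "\<And>R. R \<in> symbols \<AA> \<Longrightarrow> arity \<GG> R = arity \<AA> R"
    using assms(5) by (auto simp: same_signature_def)
  show ?thesis
    unfolding quantum_hom_iff[OF assms(4) structure_tuples[OF assms(2)]]
  proof (intro conjI ballI)
    show "quantum_function d (universe \<GG>) (universe \<BB>) (\<lambda>g. Q (h g))"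
      using Q assms(6) by (auto simp: quantum_function_def)
  next
    fix R t bs
    assume *: "R \<in> symbols \<GG>" "t \<in> interp \<GG> R" "bs \<in> tuples (universe \<BB>) (arity \<GG> R) - interp \<BB> R"
    then have "mat_prod_list d (map2 Q (map h t) bs) = 0\<^sub>m d d"
      using Q assms(7)[OF *(1,2)] sig by auto
    then show "mat_prod_list d (map2 (\<lambda>g. Q (h g)) t bs) = 0\<^sub>m d d"
      by (simp only: map2_map_left)
  next
    fix R t x y b c
    assume "R \<in> symbols \<GG>" "t \<in> interp \<GG> R" "x \<in> set t" "y \<in> set t" "b \<in> universe \<BB>" "c \<in> universe \<BB>"
    moreover from this have "h x \<in> set (map h t)" "h y \<in> set (map h t)" by auto
    ultimately show "Q (h x) b * Q (h y) c = Q (h y) c * Q (h x) b"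
      using Q assms(7) sig(1) by blast
  qed
qed

text \<open>A tuple \<open>t\<close> of \<open>R\<close> is a homomorphism
  \<open>i \<mapsto> t ! i\<close> from the one-tuple structure on \<open>[r]\<close>, along which
  \<open>Q\<close> is pulled back.\<close>

lemma quantum_hom_tuple:
  assumes "quantum_hom d \<AA> \<BB> Q" "is_structure \<AA>" "finite (universe \<BB>)"
    and "R \<in> symbols \<AA>" "t \<in> interp \<AA> R" "arity \<AA> R = r"
  shows "quantum_hom d (single_relation {..<r} r {[0..<r]}) (single_relation (universe \<BB>) r (interp \<BB> R))
    (\<lambda>i. Q (t ! i))"
proof -
  note Q = assms(1)[unfolded quantum_hom_iff[OF assms(3) structure_tuples[OF assms(2)]]]
  have t: "length t = r" "set t \<subseteq> universe \<AA>" using structure_tuple[OF assms(2,4,5)] assms(6) by auto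
  show ?thesis
    unfolding quantum_hom_single_iff[OF assms(3)]
  proof (intro conjI allI impI ballI)
    show "d \<ge> 1" using Q by (simp add: quantum_function_def)
    show "PVM d (universe \<BB>) (Q (t ! i))" if "i < r" for i
      using Q t that nth_mem[of i t] unfolding quantum_function_def by blast
    show "mat_prod_list d (map2 (\<lambda>i. Q (t ! i)) [0..<r] bs) = 0\<^sub>m d d"
      if "bs \<in> tuples (universe \<BB>) r - interp \<BB> R" for bs
      using Q assms(4-6) that unfolding map2_nth_left[OF t(1), symmetric] by blast
    show "Q (t ! i) b * Q (t ! j) c = Q (t ! j) c * Q (t ! i) b"
      if "i < r" "j < r" "b \<in> universe \<BB>" "c \<in> universe \<BB>" for i j b c
      using Q assms(4,5) that t(1) nth_mem[of i t] nth_mem[of j t] by blast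
  qed
qed

section \<open>Classical homomorphisms\<close>

text \<open>Matrices of size one multiply like complex numbers, which have no zero divisors.\<close>

lemma mat_prod_list_zero_dim_one:
  assumes "set Ms \<subseteq> carrier_mat 1 1" "mat_prod_list 1 Ms = 0\<^sub>m 1 1"
  shows "0\<^sub>m 1 1 \<in> set Ms"
  using assms
proof (induction Ms)
  case Nil
  then have "(1\<^sub>m 1 :: complex mat) $$ (0, 0) = 0\<^sub>m 1 1 $$ (0, 0)" by simp
  then show ?case by simp
next
  case (Cons M Ms)
  have c: "M \<in> carrier_mat 1 1" "mat_prod_list 1 Ms \<in> carrier_mat 1 1"
    using Cons by (auto intro: mat_prod_list_closed)
  have "(M * mat_prod_list 1 Ms) $$ (0, 0) = M $$ (0, 0) * mat_prod_list 1 Ms $$ (0, 0)"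
    using c by (simp add: scalar_prod_def)
  then have "M $$ (0, 0) = 0 \<or> mat_prod_list 1 Ms $$ (0, 0) = 0"
    using Cons.prems by simp
  then have "M = 0\<^sub>m 1 1 \<or> mat_prod_list 1 Ms = 0\<^sub>m 1 1"
  proof
    assume "M $$ (0, 0) = 0"
    then have "M = 0\<^sub>m 1 1" using c by (intro eq_matI) auto
    then show ?thesis ..
  next
    assume "mat_prod_list 1 Ms $$ (0, 0) = 0"
    then have "mat_prod_list 1 Ms = 0\<^sub>m 1 1" using c by (intro eq_matI) auto
    then show ?thesis ..
  qed
  then show ?case using Cons by auto
qed

text \<open>Projectors that are all zero would sum to zero, which differs from the identity as
  \<open>d \<ge> 1\<close>.\<close>

lemma PVM_nonzero:
  assumes "finite B" "PVM d B Q" "d \<ge> 1"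
  obtains b where "b \<in> B" "Q b \<noteq> 0\<^sub>m d d"
proof -
  have "\<not> (\<forall>b\<in>B. Q b = 0\<^sub>m d d)"
  proof
    assume "\<forall>b\<in>B. Q b = 0\<^sub>m d d"
    then have "(1\<^sub>m d :: complex mat) = 0\<^sub>m d d"
      using assms(2) msum_zero[OF assms(1), of Q d] by (simp add: PVM_def)
    then have "(1\<^sub>m d :: complex mat) $$ (0, 0) = 0\<^sub>m d d $$ (0, 0)" by simp
    then show False using assms(3) by simp
  qed
  then show thesis using that by blast
qed

text \<open>Let \<open>h\<close> choose for each vertex an outcome with nonzero projector. In
  dimension one a product of nonzero projectors is nonzero, so (QH1) does not allow
  \<open>map h t\<close> to leave the relation.\<close>

lemma quantum_hom_dim_one:
  assumes "quantum_hom 1 \<GG> \<AA> Q" "is_structure \<GG>" "finite (universe \<AA>)"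
  obtains h where "\<And>g. g \<in> universe \<GG> \<Longrightarrow> h g \<in> universe \<AA> \<and> Q g (h g) \<noteq> 0\<^sub>m 1 1"
    and "\<And>R t. R \<in> symbols \<GG> \<Longrightarrow> t \<in> interp \<GG> R \<Longrightarrow> map h t \<in> interp \<AA> R"
proof -
  have PVM: "PVM 1 (universe \<AA>) (Q g)" if "g \<in> universe \<GG>" for g
    using assms(1) that by (auto simp: quantum_hom_def quantum_function_def)
  have "\<exists>h. \<forall>g\<in>universe \<GG>. h g \<in> universe \<AA> \<and> Q g (h g) \<noteq> 0\<^sub>m 1 1"
    by (rule bchoice) (use PVM PVM_nonzero[OF assms(3)] in \<open>metis order_refl\<close>)
  then obtain h where h: "\<And>g. g \<in> universe \<GG> \<Longrightarrow> h g \<in> universe \<AA> \<and> Q g (h g) \<noteq> 0\<^sub>m 1 1"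
    by blast
  moreover have "map h t \<in> interp \<AA> R" if *: "R \<in> symbols \<GG>" "t \<in> interp \<GG> R" for R t
  proof (rule ccontr)
    assume "map h t \<notin> interp \<AA> R"
    moreover have "map h t \<in> tuples (universe \<AA>) (arity \<GG> R)"
      using structure_tuple[OF assms(2) *] h by (auto simp: tuples_def)
    ultimately have "mat_prod_list 1 (map2 Q t (map h t)) = 0\<^sub>m 1 1"
      using assms(1) * unfolding quantum_hom_def by blast
    moreover have eq: "map2 Q t (map h t) = map (\<lambda>g. Q g (h g)) t"
      by (simp add: zip_map2 zip_same_conv_map)
    moreover have "set (map (\<lambda>g. Q g (h g)) t) \<subseteq> carrier_mat 1 1"
    proof -
      have "Q g (h g) \<in> carrier_mat 1 1" if "g \<in> universe \<GG>" for g
        using PVM_carrier[OF PVM[OF that]] h[OF that] by simp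
      then show ?thesis using structure_tuple(2)[OF assms(2) *] by auto
    qed
    ultimately have "0\<^sub>m 1 1 \<in> set (map (\<lambda>g. Q g (h g)) t)"
      by (intro mat_prod_list_zero_dim_one) auto
    then obtain g where "g \<in> set t" "Q g (h g) = 0\<^sub>m 1 1" by auto
    moreover from this have "g \<in> universe \<GG>" using structure_tuple(2)[OF assms(2) *] by blast
    ultimately show False using h by blast
  qed
  ultimately show thesis using that by blast
qed

text \<open>This is the deterministic measurement with outcome \<open>s ! i\<close> at
  \<open>i\<close>. A tuple other than \<open>s\<close> disagrees with it at some position, where
  its product has a zero factor.\<close>

lemma point_quantum_hom:
  assumes "finite A" "S \<subseteq> tuples A r" "s \<in> S"
  shows "quantum_hom 1 (single_relation {..<r} r {[0..<r]}) (single_relation A r S)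
    (\<lambda>i a. if a = s ! i then 1\<^sub>m 1 else 0\<^sub>m 1 1)"
    (is "quantum_hom 1 _ _ ?Q")
  unfolding quantum_hom_single_iff[OF assms(1)]
proof (intro conjI allI impI ballI)
  fix i assume "i < r"
  then have s: "s ! i \<in> A" using assms(2,3) by (auto intro: tuples_nth)
  have "mat_adjoint (1\<^sub>m 1) = (1\<^sub>m 1 :: complex mat)" "mat_adjoint (0\<^sub>m 1 1) = (0\<^sub>m 1 1 :: complex mat)"
    by (rule eq_matI; simp)+
  then have "projector 1 (?Q i a)" for a by (simp add: projector_def)
  moreover have "msum 1 (?Q i) A = 1\<^sub>m 1"
  proof (rule msum_eqI)
    fix k l :: nat assume "k < 1" "l < 1"
    then have "(\<Sum>b\<in>A. ?Q i b $$ (k, l)) = (\<Sum>b\<in>A. if b = s ! i then 1 else 0)"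
      by (intro sum.cong) auto
    then show "(\<Sum>b\<in>A. ?Q i b $$ (k, l)) = 1\<^sub>m 1 $$ (k, l)"
      using \<open>k < 1\<close> \<open>l < 1\<close> s assms(1) by simp
  qed (use assms(1) in auto)
  ultimately show "PVM 1 A (?Q i)" by (simp add: PVM_def)
next
  fix bs assume bs: "bs \<in> tuples A r - S"
  then have len: "length bs = r" "length s = r" using assms(2,3) by (auto simp: tuples_def)
  then obtain i where i: "i < r" "bs ! i \<noteq> s ! i" using bs assms(3) by (metis DiffE nth_equalityI)
  then have zero: "0\<^sub>m 1 1 \<in> set (map2 ?Q [0..<r] bs)"
    using len set_map2I[of i "[0..<r]" bs ?Q] by simp
  have c: "set (map2 ?Q [0..<r] bs) \<subseteq> carrier_mat 1 1"
    by (auto split: if_splits)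
  \<comment> \<open>The annihilation lemma is used with the identity in the role of \<open>M\<close>
    and the zero factor in the role of \<open>X\<close>.\<close>
  have "1\<^sub>m 1 * X = X * 1\<^sub>m 1" if "X \<in> set (map2 ?Q [0..<r] bs)" for X
    using subsetD[OF c that] by simp
  moreover have "1\<^sub>m 1 * 0\<^sub>m 1 1 = (0\<^sub>m 1 1 :: complex mat)" by simp
  ultimately have "1\<^sub>m 1 * mat_prod_list 1 (map2 ?Q [0..<r] bs) = 0\<^sub>m 1 1"
    using mult_mat_prod_list_eq_zero[OF one_carrier_mat c _ zero] by blast
  then show "mat_prod_list 1 (map2 ?Q [0..<r] bs) = 0\<^sub>m 1 1"
    using mat_prod_list_closed[OF c] by simp
qed simp_all

section \<open>Powers as q-definitions\<close>

text \<open>The coordinate projections \<open>x \<mapsto> x ! i\<close> are homomorphisms from the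
  power to \<open>\<AA>\<close>, and \<open>P\<close> selects one of them: multiplied by
  \<open>P i\<close>, the PVM at \<open>x\<close> becomes deterministic with outcome
  \<open>x ! i\<close>.\<close>

lemma quantum_hom_projections:
  assumes "is_structure \<AA>" "d \<ge> 1" "PVM d {..<n} P"
  shows "quantum_hom d (power_structure \<AA> n) \<AA> (\<lambda>x a. msum d P {i \<in> {..<n}. x ! i = a})"
    (is "quantum_hom d _ _ ?Q")
proof -
  have fin: "finite (universe \<AA>)" using assms(1) by (simp add: is_structure_def)
  note P = PVM_carrier[OF assms(3)]
  have Q: "?Q x a \<in> carrier_mat d d" for x a using P by (intro msum_closed) auto
  have PQ: "P i * ?Q x a = (if x ! i = a then P i else 0\<^sub>m d d)" if "i < n" for i x a
  proof -
    have "{i \<in> {..<n}. x ! i = a} \<subseteq> {..<n}" by auto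
    from PVM_mult_msum[OF finite_lessThan assms(3) _ this, of i] that show ?thesis by simp
  qed
  have PQ_comm: "P i * ?Q x a = ?Q x a * P i" if "i < n" for i x a
    by (rule msum_commute) (use P that PVM_commute[OF _ assms(3)] in auto)
  show ?thesis
    unfolding quantum_hom_iff[OF fin structure_tuples[OF is_structure_power[OF assms(1)]]]
  proof (intro conjI ballI)
    show "quantum_function d (universe (power_structure \<AA> n)) (universe \<AA>) ?Q"
      unfolding quantum_function_def power_structure_simps
    proof (intro conjI ballI PVM_coarsen)
      show "x ! i \<in> universe \<AA>" if "x \<in> tuples (universe \<AA>) n" "i \<in> {..<n}" for x i
        using tuples_nth[OF that(1)] that(2) by simp
    qed (use assms fin in auto)
  next
    fix R t bs
    assume "R \<in> symbols (power_structure \<AA> n)" "t \<in> interp (power_structure \<AA> n) R"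
      "bs \<in> tuples (universe \<AA>) (arity (power_structure \<AA> n) R) - interp \<AA> R"
    then have t: "\<And>i. i < n \<Longrightarrow> map (\<lambda>b. b ! i) t \<in> interp \<AA> R" "bs \<notin> interp \<AA> R"
      and len: "length t = length bs"
      by (auto simp: interp_power_structure tuples_def)
    define M where "M = mat_prod_list d (map2 ?Q t bs)"
    have c: "set (map2 ?Q t bs) \<subseteq> carrier_mat d d" using Q by auto
    then have M: "M \<in> carrier_mat d d" unfolding M_def by (rule mat_prod_list_closed)
    \<comment> \<open>The \<open>i\<close>-th projection maps \<open>t\<close> into the relation,
      hence not to \<open>bs\<close>. At a position \<open>m\<close> where they differ,
      \<open>P i\<close> annihilates the factor, and it commutes with all other factors.\<close>
    have "P i * M = 0\<^sub>m d d" if i: "i < n" for i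
    proof -
      have "map (\<lambda>b. b ! i) t \<noteq> bs" using t i by blast
      then obtain m where m: "m < length bs" "t ! m ! i \<noteq> bs ! m"
        using len by (auto simp: list_eq_iff_nth_eq)
      show ?thesis
        unfolding M_def
      proof (rule mult_mat_prod_list_eq_zero)
        show "?Q (t ! m) (bs ! m) \<in> set (map2 ?Q t bs)"
          using m len by (intro set_map2I) auto
        show "P i * X = X * P i" if "X \<in> set (map2 ?Q t bs)" for X
          using that PQ_comm[OF i] by auto
      qed (use P i c m PQ in auto)
    qed
    \<comment> \<open>The \<open>P i\<close> sum to the identity, so \<open>M\<close> itself
      vanishes.\<close>
    then have "msum d (\<lambda>i. P i * M) {..<n} = 0\<^sub>m d d" by (intro msum_zero) auto
    then have "msum d P {..<n} * M = 0\<^sub>m d d" using msum_mult[OF finite_lessThan P M] by simp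
    then show "mat_prod_list d (map2 ?Q t bs) = 0\<^sub>m d d"
      using assms(3) M by (simp add: PVM_def M_def)
  next
    fix x y a b
    show "?Q x a * ?Q y b = ?Q y b * ?Q x a"
      by (rule msum_commute) (use P Q PQ_comm in auto)
  qed
qed

text \<open>The joint PVM of \<open>Q 0, ..., Q (r - 1)\<close> lives on all
  \<open>r\<close>-tuples, but (QH1) makes it vanish outside \<open>S\<close>, so it restricts to a
  PVM on \<open>S\<close>. Its marginals are the given PVMs.\<close>

lemma single_quantum_hom_joint_PVM:
  assumes "finite A" "S \<subseteq> tuples A r"
    and "quantum_hom d (single_relation {..<r} r {[0..<r]}) (single_relation A r S) Q"
  obtains P where "PVM d S P"
    and "\<And>j a. j < r \<Longrightarrow> a \<in> A \<Longrightarrow> msum d P {s \<in> S. s ! j = a} = Q j a"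
proof -
  note Q = assms(3)[unfolded quantum_hom_single_iff[OF assms(1)]]
  note fin = finite_tuples[OF assms(1), of r]
  define P where "P s = mat_prod_list d (map2 Q [0..<r] s)" for s
  have PVM: "PVM d (tuples A r) P"
    using PVM_mat_prod_list[OF assms(1), of "[0..<r]" d Q] Q unfolding P_def by simp
  have zero: "P s = 0\<^sub>m d d" if "s \<in> tuples A r - S" for s using Q that unfolding P_def by blast
  note cP = PVM_carrier[OF PVM]
  have "msum d P {s \<in> S. s ! j = a} = Q j a" if ja: "j < r" "a \<in> A" for j a
  proof -
    have Qj: "PVM d A (Q j)" using Q ja by blast
    note cQ = PVM_carrier[OF Qj ja(2)]
    \<comment> \<open>Multiplication by \<open>Q j a\<close> keeps the tuples with
      \<open>j\<close>-th entry \<open>a\<close> and kills the others, because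
      \<open>Q j (s ! j)\<close> is a factor of \<open>P s\<close>.\<close>
    have QP: "Q j a * P s = (if s ! j = a then P s else 0\<^sub>m d d)" if s: "s \<in> tuples A r" for s
    proof -
      have c: "set (map2 Q [0..<r] s) \<subseteq> carrier_mat d d"
        by (rule map2_carrier[where B = A]) (use Q s in \<open>auto simp: tuples_def\<close>)
      have comm: "Q j a * X = X * Q j a" if X: "X \<in> set (map2 Q [0..<r] s)" for X
      proof -
        obtain i b where "i \<in> set [0..<r]" "b \<in> set s" "X = Q i b" using X by (rule set_map2E)
        then show ?thesis using Q ja s by (auto simp: tuples_def)
      qed
      have mem: "Q j (s ! j) \<in> set (map2 Q [0..<r] s)"
        using s ja set_map2I[of j "[0..<r]" s Q] by (auto simp: tuples_def)
      have mult: "Q j a * Q j (s ! j) = (if a = s ! j then Q j (s ! j) else 0\<^sub>m d d)"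
        using PVM_mult[OF assms(1) Qj ja(2) tuples_nth[OF s ja(1)]] .
      show ?thesis
      proof (cases "s ! j = a")
        case True
        then show ?thesis using mult_mat_prod_list_absorb[OF cQ c comm mem] mult by (simp add: P_def)
      next
        case False
        then show ?thesis using mult_mat_prod_list_eq_zero[OF cQ c comm mem] mult by (simp add: P_def)
      qed
    qed
    \<comment> \<open>With the factor \<open>Q j a\<close> inserted, all terms outside the index set
      are zero. The sum may thus run over all tuples, where \<open>P\<close> sums to the
      identity.\<close>
    have "msum d P {s \<in> S. s ! j = a} = msum d (\<lambda>s. Q j a * P s) {s \<in> S. s ! j = a}"
      by (rule msum_cong) (use assms(2) fin cP QP in \<open>auto intro: finite_subset\<close>)
    also have "\<dots> = msum d (\<lambda>s. Q j a * P s) (tuples A r)"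
      by (rule msum_restrict) (use assms(2) fin cP cQ QP zero in auto)
    also have "\<dots> = Q j a * msum d P (tuples A r)" using fin cP cQ by (intro mult_msum[symmetric])
    finally show ?thesis using PVM cQ by (simp add: PVM_def)
  qed
  moreover have "PVM d S P" using PVM_subset[OF fin PVM assms(2) zero] .
  ultimately show thesis using that by blast
qed

text \<open>\<open>e\<close> enumerates \<open>S\<close>, with \<open>n = 0\<close> if
  \<open>S\<close> is empty. The last hypothesis is (q2) at the distinguished vertices; (q1) is
  established for every structure and every \<open>S\<close>, with no reference to polymorphisms of
  \<open>\<BB>\<close>.\<close>

lemma power_q_definition:
  fixes \<AA> :: "('s, 'a) rel_structure"
  assumes "is_structure \<AA>" "S \<subseteq> tuples (universe \<AA>) r" "bij_betw e {..<n} S"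
    and "\<And>d Q. quantum_hom d (power_structure \<AA> n) \<AA> Q \<Longrightarrow>
      quantum_hom d (single_relation {..<r} r {[0..<r]}) (single_relation (universe \<AA>) r S)
        (\<lambda>j. Q (map (\<lambda>i. e i ! j) [0..<n]))"
  shows "q_definition \<AA> r S (power_structure \<AA> n) (map (\<lambda>j. map (\<lambda>i. e i ! j) [0..<n]) [0..<r])"
    (is "q_definition _ _ _ _ ?gs")
  unfolding q_definition_def Let_def
proof (intro conjI allI impI)
  have fin: "finite (universe \<AA>)" using assms(1) by (simp add: is_structure_def)
  have e: "e i \<in> S" if "i < n" for i using assms(3) that by (auto dest: bij_betwE)
  show "?gs \<in> tuples (universe (power_structure \<AA> n)) r"
    using e assms(2) by (fastforce simp: tuples_def)
  fix d Q
  {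
    assume "quantum_hom d (single_relation {..<r} r {[0..<r]}) (single_relation (universe \<AA>) r S) Q"
    note Q = this
    then obtain P where P: "PVM d S P"
      "\<And>j a. j < r \<Longrightarrow> a \<in> universe \<AA> \<Longrightarrow> msum d P {s \<in> S. s ! j = a} = Q j a"
      using single_quantum_hom_joint_PVM[OF fin assms(2)] by blast
    have d: "d \<ge> 1" using Q unfolding quantum_hom_single_iff[OF fin] by blast
    define Q' :: "'a list \<Rightarrow> 'a \<Rightarrow> complex mat" where "Q' x a = msum d (\<lambda>i. P (e i)) {i \<in> {..<n}. x ! i = a}" for x a
    have "quantum_hom d (power_structure \<AA> n) \<AA> Q'"
      unfolding Q'_def using PVM_reindex[OF _ assms(3) P(1)] assms(1) d
      by (intro quantum_hom_projections) auto
    moreover have "Q' (?gs ! j) a = Q j a" if "j < r" "a \<in> universe \<AA>" for j a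
    proof -
      \<comment> \<open>The \<open>i\<close>-th entry of the \<open>j\<close>-th distinguished
        vertex is \<open>e i ! j\<close>, so the fibre defining \<open>Q'\<close> there is the set
        of indices of the tuples summed in the marginal at \<open>j\<close>.\<close>
      have "bij_betw e {i \<in> {..<n}. e i ! j = a} {s \<in> S. s ! j = a}"
        using assms(3) by (auto simp: bij_betw_def inj_on_def)
      then have "msum d (\<lambda>i. P (e i)) {i \<in> {..<n}. e i ! j = a} = msum d P {s \<in> S. s ! j = a}"
        using PVM_carrier[OF P(1)] by (intro msum_reindex_bij_betw) auto
      moreover have "{i \<in> {..<n}. ?gs ! j ! i = a} = {i \<in> {..<n}. e i ! j = a}"
        using that by auto
      ultimately show ?thesis unfolding Q'_def using P(2)[OF that] by simp
    qed
    ultimately show "\<exists>Q'. quantum_hom d (power_structure \<AA> n) \<AA> Q' \<and>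
        (\<forall>j<r. \<forall>a\<in>universe \<AA>. Q' (?gs ! j) a = Q j a)"
      by blast
  next
    assume "quantum_hom d (power_structure \<AA> n) \<AA> Q"
    from assms(4)[OF this]
    show "quantum_hom d (single_relation {..<r} r {[0..<r]}) (single_relation (universe \<AA>) r S)
        (\<lambda>j. Q (?gs ! j))"
      by (rule single_quantum_hom_cong) (simp_all add: fin)
  }
qed (use assms(1) is_structure_power same_signature_power in auto)

section \<open>Transport of q-definitions along injections\<close>

definition image_structure :: "('g \<Rightarrow> 'h) \<Rightarrow> ('s, 'g) rel_structure \<Rightarrow> ('s, 'h) rel_structure" where
  "image_structure f \<GG> = \<lparr>universe = f ` universe \<GG>, symbols = symbols \<GG>, arity = arity \<GG>,
     interp = (\<lambda>R. map f ` interp \<GG> R)\<rparr>"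

lemma image_structure_simps [simp]:
  "universe (image_structure f \<GG>) = f ` universe \<GG>"
  "symbols (image_structure f \<GG>) = symbols \<GG>"
  "arity (image_structure f \<GG>) = arity \<GG>"
  "interp (image_structure f \<GG>) R = map f ` interp \<GG> R"
  by (simp_all add: image_structure_def)

lemma is_structure_image: "is_structure \<GG> \<Longrightarrow> is_structure (image_structure f \<GG>)"
  unfolding is_structure_def tuples_def by fastforce

text \<open>On the vertices \<open>f\<close> and its inverse are homomorphisms, and both conditions
  are transferred by composing with one of them. This moves a q-definition with vertices of type
  \<open>'a list\<close> to the natural numbers required by \<open>q_defines\<close>.\<close>

lemma q_definition_image:
  assumes "q_definition \<AA> r S \<GG> gs" "is_structure \<AA>" "inj_on f (universe \<GG>)"
  shows "q_definition \<AA> r S (image_structure f \<GG>) (map f gs)"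
  unfolding q_definition_def Let_def
proof (intro conjI allI impI)
  have \<GG>: "is_structure \<GG>" "same_signature \<GG> \<AA>" "gs \<in> tuples (universe \<GG>) r"
    using assms(1) by (auto simp: q_definition_def Let_def)
  have fin: "finite (universe \<AA>)" using assms(2) by (simp add: is_structure_def)
  have gs: "length gs = r" "\<And>i. i < r \<Longrightarrow> gs ! i \<in> universe \<GG>"
    using \<GG>(3) by (auto simp: tuples_def)
  define g where "g = inv_into (universe \<GG>) f"
  have g: "g (f x) = x" if "x \<in> universe \<GG>" for x using assms(3) that by (simp add: g_def)
  show "is_structure (image_structure f \<GG>)" using \<GG>(1) by (rule is_structure_image)
  show "same_signature (image_structure f \<GG>) \<AA>" using \<GG>(2) by (simp add: same_signature_def)
  show "map f gs \<in> tuples (universe (image_structure f \<GG>)) r"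
    using \<GG>(3) by (auto simp: tuples_def)
  fix d Q
  {
    assume "quantum_hom d (single_relation {..<r} r {[0..<r]}) (single_relation (universe \<AA>) r S) Q"
    then obtain Q' where Q': "quantum_hom d \<GG> \<AA> Q'" "\<And>i a. i < r \<Longrightarrow> a \<in> universe \<AA> \<Longrightarrow> Q' (gs ! i) a = Q i a"
      using assms(1) unfolding q_definition_def Let_def by blast
    have "quantum_hom d (image_structure f \<GG>) \<AA> (\<lambda>x. Q' (g x))"
    proof (rule quantum_hom_comp[OF Q'(1) is_structure_image[OF \<GG>(1)] \<GG>(1) fin])
      fix R t assume *: "R \<in> symbols (image_structure f \<GG>)" "t \<in> interp (image_structure f \<GG>) R"
      then obtain s where s: "t = map f s" "s \<in> interp \<GG> R" by auto
      then have "map g t = s"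
        using structure_tuple(2)[OF \<GG>(1) _ s(2)] * g by (auto intro!: map_idI)
      then show "map g t \<in> interp \<GG> R" using s by simp
    qed (auto simp: same_signature_def g)
    moreover have "Q' (g (map f gs ! i)) a = Q i a" if "i < r" "a \<in> universe \<AA>" for i a
      using Q'(2)[OF that] gs g that(1) by simp
    ultimately show "\<exists>Q'. quantum_hom d (image_structure f \<GG>) \<AA> Q' \<and>
        (\<forall>i<r. \<forall>a\<in>universe \<AA>. Q' (map f gs ! i) a = Q i a)"
      by (intro exI[of _ "\<lambda>x. Q' (g x)"]) blast
  next
    assume Q: "quantum_hom d (image_structure f \<GG>) \<AA> Q"
    have "quantum_hom d \<GG> \<AA> (\<lambda>x. Q (f x))"
      by (rule quantum_hom_comp[OF Q \<GG>(1) is_structure_image[OF \<GG>(1)] fin])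
        (auto simp: same_signature_def)
    then have "quantum_hom d (single_relation {..<r} r {[0..<r]}) (single_relation (universe \<AA>) r S)
        (\<lambda>i. Q (f (gs ! i)))"
      using assms(1) unfolding q_definition_def Let_def by blast
    then show "quantum_hom d (single_relation {..<r} r {[0..<r]}) (single_relation (universe \<AA>) r S)
        (\<lambda>i. Q (map f gs ! i))"
      by (rule single_quantum_hom_cong) (simp_all add: fin gs)
  }
qed

section \<open>The zeroth power\<close>

text \<open>The only vertex \<open>[]\<close> of the zeroth power carries all constant tuples, as
  there are no coordinates to check. For an outcome \<open>a\<close> with nonzero projector, the
  product along such a tuple is a power of \<open>Q [] a\<close>, hence nonzero, and (QH1) puts the
  constant tuple of \<open>a\<close> into every relation.\<close>

lemma no_quantum_hom_power_zero:
  assumes "quantum_hom d (power_structure \<AA> 0) \<AA> Q" "is_structure \<AA>"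
  obtains a where "a \<in> universe \<AA>" "\<And>R. R \<in> symbols \<AA> \<Longrightarrow> replicate (arity \<AA> R) a \<in> interp \<AA> R"
proof -
  have fin: "finite (universe \<AA>)" using assms(2) by (simp add: is_structure_def)
  have PVM: "PVM d (universe \<AA>) (Q [])" and d: "d \<ge> 1"
    using assms(1) by (auto simp: quantum_hom_def quantum_function_def tuples_def)
  obtain a where a: "a \<in> universe \<AA>" "Q [] a \<noteq> 0\<^sub>m d d" using PVM_nonzero[OF fin PVM d] .
  have "replicate (arity \<AA> R) a \<in> interp \<AA> R" if R: "R \<in> symbols \<AA>" for R
  proof (rule ccontr)
    define k where "k = arity \<AA> R"
    assume "replicate (arity \<AA> R) a \<notin> interp \<AA> R"
    moreover have "replicate k a \<in> tuples (universe \<AA>) k" using a(1) by (auto simp: tuples_def)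
    moreover have "replicate k [] \<in> interp (power_structure \<AA> 0) R"
      by (auto simp: interp_power_structure tuples_def k_def)
    ultimately have "mat_prod_list d (map2 Q (replicate k []) (replicate k a)) = 0\<^sub>m d d"
      using assms(1) R unfolding quantum_hom_def power_structure_simps k_def by blast
    \<comment> \<open>By idempotence a nonempty product of copies of \<open>Q [] a\<close> is
      \<open>Q [] a\<close>; arities are at least one.\<close>
    moreover have "mat_prod_list d (replicate (Suc m) (Q [] a)) = Q [] a" for m
      using PVM_carrier[OF PVM a(1)] PVM_idem[OF PVM a(1)] by (induction m) auto
    moreover obtain m where "k = Suc m"
      using assms(2) R by (auto simp: is_structure_def k_def dest!: bspec intro: that[of "k - 1"])
    ultimately show False using a(2) by (simp add: zip_replicate)
  qed
  then show thesis using that a(1) by blast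
qed

section \<open>The two implications\<close>

lemma q_defines_imp_qPol_subset:
  fixes \<AA> :: "('s, 'a) rel_structure" and \<BB> :: "('t, 'a) rel_structure"
  assumes "is_structure \<AA>" "is_structure \<BB>" "universe \<AA> = universe \<BB>" "q_defines \<AA> \<BB>"
  shows "qPol \<AA> \<subseteq> qPol \<BB>"
proof -
  have fin: "finite (universe \<AA>)" using assms(1) by (simp add: is_structure_def)
  have "quantum_hom d (power_structure \<BB> n) \<BB> Q" if Q: "quantum_hom d (power_structure \<AA> n) \<AA> Q" for n d Q
    unfolding quantum_hom_iff[OF fin[unfolded assms(3)] structure_tuples[OF is_structure_power[OF assms(2)]]]
  proof (rule conjI, goal_cases)
    case 1
    then show ?case using Q assms(3) by (simp add: quantum_hom_def)
  next
    case 2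
    show ?case
    proof (intro ballI)
      fix R t assume R: "R \<in> symbols (power_structure \<BB> n)" and t: "t \<in> interp (power_structure \<BB> n) R"
      define r where "r = arity \<BB> R"
      obtain \<GG> :: "('s, nat) rel_structure" and gs where qd: "q_definition \<AA> r (interp \<BB> R) \<GG> gs"
        using assms(4) R unfolding q_defines_def r_def by auto
      then have \<GG>: "is_structure \<GG>" "same_signature \<GG> \<AA>" "gs \<in> tuples (universe \<GG>) r"
        by (auto simp: q_definition_def Let_def)
      have S: "interp \<BB> R \<subseteq> tuples (universe \<AA>) r"
        using assms(2,3) R by (simp add: is_structure_def r_def)
      have t': "t \<in> tuples (tuples (universe \<AA>) n) r"
        "\<And>i. i < n \<Longrightarrow> map (\<lambda>b. b ! i) t \<in> interp \<BB> R"
        using t by (auto simp: interp_power_structure r_def assms(3))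
      have len: "length t = r" "length gs = r" using t' \<GG>(3) by (auto simp: tuples_def)
      \<comment> \<open>The \<open>i\<close>-th coordinates of \<open>t\<close> form a tuple of the
        relation, which extends to a classical homomorphism from \<open>\<GG>\<close> taking the
        distinguished vertices to it.\<close>
      have "\<exists>h. (\<forall>g\<in>universe \<GG>. h g \<in> universe \<AA>) \<and>
          (\<forall>R\<in>symbols \<GG>. \<forall>t\<in>interp \<GG> R. map h t \<in> interp \<AA> R) \<and> (\<forall>j<r. h (gs ! j) = t ! j ! i)"
        if i: "i < n" for i
      proof -
        let ?s = "map (\<lambda>b. b ! i) t"
        obtain Q' where Q': "quantum_hom 1 \<GG> \<AA> Q'"
          "\<And>j a. j < r \<Longrightarrow> a \<in> universe \<AA> \<Longrightarrow> Q' (gs ! j) a = (if a = ?s ! j then 1\<^sub>m 1 else 0\<^sub>m 1 1)"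
          using qd point_quantum_hom[OF fin S t'(2)[OF i]] unfolding q_definition_def Let_def by blast
        obtain h where h: "\<And>g. g \<in> universe \<GG> \<Longrightarrow> h g \<in> universe \<AA> \<and> Q' g (h g) \<noteq> 0\<^sub>m 1 1"
          "\<And>R t. R \<in> symbols \<GG> \<Longrightarrow> t \<in> interp \<GG> R \<Longrightarrow> map h t \<in> interp \<AA> R"
          using quantum_hom_dim_one[OF Q'(1) \<GG>(1) fin] by blast
        \<comment> \<open>At \<open>gs ! j\<close> the only outcome with nonzero projector is
          \<open>?s ! j\<close>, so \<open>h\<close> had to choose it.\<close>
        have "h (gs ! j) = t ! j ! i" if "j < r" for j
        proof -
          have "gs ! j \<in> universe \<GG>" using \<GG>(3) that by (rule tuples_nth)
          then show ?thesis using h(1)[of "gs ! j"] Q'(2)[OF that, of "h (gs ! j)"] len that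
            by (auto split: if_splits)
        qed
        then show ?thesis using h by blast
      qed
      then obtain h where h: "\<And>i g. i < n \<Longrightarrow> g \<in> universe \<GG> \<Longrightarrow> h i g \<in> universe \<AA>"
        "\<And>i R t. i < n \<Longrightarrow> R \<in> symbols \<GG> \<Longrightarrow> t \<in> interp \<GG> R \<Longrightarrow> map (h i) t \<in> interp \<AA> R"
        "\<And>i j. i < n \<Longrightarrow> j < r \<Longrightarrow> h i (gs ! j) = t ! j ! i"
        by metis
      \<comment> \<open>The \<open>n\<close> homomorphisms are the coordinates of one homomorphism
        from \<open>\<GG>\<close> to the power, which maps \<open>gs\<close> to \<open>t\<close>.
        What (q2) yields for \<open>Q\<close> after \<open>H\<close> is therefore a statement on
        \<open>Q\<close> along \<open>t\<close>.\<close>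
      define H where "H g = map (\<lambda>i. h i g) [0..<n]" for g
      have "quantum_hom d \<GG> \<AA> (\<lambda>g. Q (H g))"
      proof (rule quantum_hom_comp[OF Q \<GG>(1) is_structure_power[OF assms(1)] fin])
        show "same_signature \<GG> (power_structure \<AA> n)" using \<GG>(2) by (simp add: same_signature_def)
        show H: "H g \<in> universe (power_structure \<AA> n)" if "g \<in> universe \<GG>" for g
          using that h(1) by (auto simp: H_def tuples_def)
        fix R t assume *: "R \<in> symbols \<GG>" "t \<in> interp \<GG> R"
        then have "length t = arity \<AA> R" "set t \<subseteq> universe \<GG>"
          using structure_tuple[OF \<GG>(1) *] \<GG>(2) by (auto simp: same_signature_def)
        then have "map H t \<in> tuples (tuples (universe \<AA>) n) (arity \<AA> R)"
          using H by (auto simp: tuples_def[of "tuples (universe \<AA>) n"])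
        moreover have "map (\<lambda>b. b ! i) (map H t) = map (h i) t" if "i < n" for i
          using that by (simp add: H_def)
        ultimately show "map H t \<in> interp (power_structure \<AA> n) R"
          using h(2) * by (simp add: interp_power_structure del: map_map)
      qed
      then have single: "quantum_hom d (single_relation {..<r} r {[0..<r]})
          (single_relation (universe \<AA>) r (interp \<BB> R)) (\<lambda>j. Q (H (gs ! j)))"
        using qd unfolding q_definition_def Let_def by blast
      have Ht: "map (\<lambda>j. H (gs ! j)) [0..<r] = t"
      proof (rule nth_equalityI)
        fix j assume "j < length (map (\<lambda>j. H (gs ! j)) [0..<r])"
        then have j: "j < r" by simp
        have "t ! j \<in> tuples (universe \<AA>) n" using t'(1) j by (rule tuples_nth)
        then have "H (gs ! j) = t ! j" using h(3) j by (auto simp: H_def tuples_def intro: nth_equalityI)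
        then show "map (\<lambda>j. H (gs ! j)) [0..<r] ! j = t ! j" using j by simp
      qed (use len in simp)
      have Ht': "H (gs ! j) = t ! j" if "j < r" for j
        using arg_cong[OF Ht, of "\<lambda>xs. xs ! j"] that by simp
      note single = single[unfolded assms(3), unfolded quantum_hom_single_iff[OF fin[unfolded assms(3)]]]
      show "(\<forall>bs\<in>tuples (universe \<BB>) (arity (power_structure \<BB> n) R) - interp \<BB> R.
            mat_prod_list d (map2 Q t bs) = 0\<^sub>m d d) \<and>
          (\<forall>x\<in>set t. \<forall>y\<in>set t. \<forall>b\<in>universe \<BB>. \<forall>c\<in>universe \<BB>. Q x b * Q y c = Q y c * Q x b)"
      proof (intro conjI ballI)
        fix bs assume "bs \<in> tuples (universe \<BB>) (arity (power_structure \<BB> n) R) - interp \<BB> R"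
        then have "mat_prod_list d (map2 (\<lambda>j. Q (H (gs ! j))) [0..<r] bs) = 0\<^sub>m d d"
          using single by (simp add: r_def)
        then show "mat_prod_list d (map2 Q t bs) = 0\<^sub>m d d"
          using map2_map_left[of Q "\<lambda>j. H (gs ! j)" "[0..<r]" bs] Ht by simp
      next
        fix x y b c
        assume xy: "x \<in> set t" "y \<in> set t" and bc: "b \<in> universe \<BB>" "c \<in> universe \<BB>"
        obtain i j where ij: "i < r" "j < r" "t ! i = x" "t ! j = y"
          using xy len(1) by (auto simp: in_set_conv_nth)
        then have "Q (H (gs ! i)) b * Q (H (gs ! j)) c = Q (H (gs ! j)) c * Q (H (gs ! i)) b"
          using single bc by blast
        then show "Q x b * Q y c = Q y c * Q x b"
          by (simp only: Ht'[OF ij(1)] Ht'[OF ij(2)] ij(3,4))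
      qed
    qed
  qed
  then show ?thesis unfolding qPol_def by auto
qed

lemma qPol_subset_imp_q_defines:
  fixes \<AA> :: "('s, 'a) rel_structure" and \<BB> :: "('t, 'a) rel_structure"
  assumes "is_structure \<AA>" "is_structure \<BB>" "universe \<AA> = universe \<BB>" "qPol \<AA> \<subseteq> qPol \<BB>"
    and "(\<forall>R\<in>symbols \<BB>. interp \<BB> R \<noteq> {}) \<or>
         \<not> (\<exists>a\<in>universe \<AA>. \<forall>R\<in>symbols \<AA>. replicate (arity \<AA> R) a \<in> interp \<AA> R)"
  shows "q_defines \<AA> \<BB>"
  unfolding q_defines_def
proof
  fix R assume R: "R \<in> symbols \<BB>"
  define r S where "r = arity \<BB> R" and "S = interp \<BB> R"
  have fin: "finite (universe \<BB>)" using assms(2) by (simp add: is_structure_def)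
  have S: "S \<subseteq> tuples (universe \<AA>) r"
    using assms(2,3) R by (simp add: is_structure_def r_def S_def)
  then have "finite S" using fin assms(3) by (auto intro: finite_subset finite_tuples)
  then obtain n e where e: "bij_betw e {..<n::nat} S"
    by (metis ex_bij_betw_nat_finite atLeast0LessThan)
  let ?g = "\<lambda>j. map (\<lambda>i. e i ! j) [0..<n]"
  have "q_definition \<AA> r S (power_structure \<AA> n) (map ?g [0..<r])"
  proof (rule power_q_definition[OF assms(1) S e])
    fix d Q assume Q: "quantum_hom d (power_structure \<AA> n) \<AA> Q"
    \<comment> \<open>\<open>qPol\<close> consists of polymorphisms of positive arity. The remaining
      case \<open>n = 0\<close> is that of empty \<open>S\<close>, in which a quantum homomorphism
      from the zeroth power gives a constant excluded by the last hypothesis.\<close>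
    have "n \<ge> 1"
    proof (rule ccontr)
      assume "\<not> n \<ge> 1"
      then have "n = 0" by simp
      then have "S = {}" using e by (simp add: bij_betw_def)
      moreover obtain a where "a \<in> universe \<AA>"
        "\<And>R. R \<in> symbols \<AA> \<Longrightarrow> replicate (arity \<AA> R) a \<in> interp \<AA> R"
        using no_quantum_hom_power_zero[OF Q[unfolded \<open>n = 0\<close>] assms(1)] by blast
      ultimately show False using assms(5) R unfolding S_def by blast
    qed
    then have Q': "quantum_hom d (power_structure \<BB> n) \<BB> Q"
      using Q assms(4) unfolding qPol_def by auto
    let ?t = "map ?g [0..<r]"
    have eS: "e i \<in> S" if "i < n" for i using e that by (auto dest: bij_betwE)
    have el: "length (e i) = r" if "i < n" for i using eS[OF that] S by (auto simp: tuples_def)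
    \<comment> \<open>Taking \<open>i\<close>-th coordinates of the distinguished vertices returns
      \<open>e i\<close>, a tuple of \<open>S\<close>; so they form a tuple of the power of
      \<open>\<BB>\<close>, along which the polymorphism \<open>Q\<close> satisfies (QH1) and
      (QH2).\<close>
    have "?t \<in> interp (power_structure \<BB> n) R"
      unfolding interp_power_structure
    proof (intro conjI allI impI)
      show "?t \<in> tuples (tuples (universe \<BB>) n) (arity \<BB> R)"
        using eS S assms(3) by (fastforce simp: tuples_def r_def)
      fix i assume i: "i < n"
      then have "map (\<lambda>b. b ! i) ?t = e i" using el[OF i] by (auto intro: nth_equalityI)
      then show "map (\<lambda>b. b ! i) ?t \<in> interp \<BB> R" using eS[OF i] by (simp add: S_def)
    qed
    then have "quantum_hom d (single_relation {..<r} r {[0..<r]}) (single_relation (universe \<BB>) r (interp \<BB> R))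
        (\<lambda>j. Q (?t ! j))"
      using R by (intro quantum_hom_tuple[OF Q' is_structure_power[OF assms(2)] fin]) (auto simp: r_def)
    then show "quantum_hom d (single_relation {..<r} r {[0..<r]}) (single_relation (universe \<AA>) r S)
        (\<lambda>j. Q (?g j))"
      unfolding assms(3) S_def by (rule single_quantum_hom_cong) (simp_all add: fin)
  qed
  moreover obtain f :: "'a list \<Rightarrow> nat" where "inj_on f (universe (power_structure \<AA> n))"
    using finite_imp_inj_to_nat_seg[of "tuples (universe \<AA>) n"] finite_tuples[OF fin, of n] assms(3)
    by auto
  ultimately have "q_definition \<AA> r S (image_structure f (power_structure \<AA> n)) (map f (map ?g [0..<r]))"
    using assms(1) by (intro q_definition_image)
  then show "\<exists>(\<GG> :: ('s, nat) rel_structure) gs. q_definition \<AA> (arity \<BB> R) (interp \<BB> R) \<GG> gs"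
    unfolding r_def S_def by blast
qed

text \<open>The last hypothesis concerns empty relations. They are preserved by every quantum
  function of positive arity, but if all constant tuples of some \<open>a\<close> lie in the
  relations of \<open>\<AA>\<close>, then every candidate \<open>\<GG>\<close> has the constant
  homomorphism to \<open>a\<close>, which violates (q2).\<close>

theorem theorem5:
  fixes \<AA> :: "('s, 'a) rel_structure" and \<BB> :: "('t, 'a) rel_structure"
  assumes "is_structure \<AA>" and "is_structure \<BB>"
    and "universe \<AA> = universe \<BB>"
    and "(\<forall>R\<in>symbols \<BB>. interp \<BB> R \<noteq> {}) \<or>
         \<not> (\<exists>a\<in>universe \<AA>. \<forall>R\<in>symbols \<AA>. replicate (arity \<AA> R) a \<in> interp \<AA> R)"
  shows "q_defines \<AA> \<BB> \<longleftrightarrow> qPol \<AA> \<subseteq> qPol \<BB>"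
  using q_defines_imp_qPol_subset[OF assms(1-3)] qPol_subset_imp_q_defines[OF assms(1-3) _ assms(4)] by blast

end
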